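(* Let $K>0$. Let $(\xi^*,\lambda^* )\in\mathbb{R}^\nu\times\mathbb{R}^m$ satisfy the second-order sufficient conditions of the constrained problem (C) defined in the context. Then, if $\tau$ is sufficiently small (i.e. there is $\bar\tau>0$ such that for every $\tau\in(0,\bar\tau)$), $(\xi^*,\lambda^* )$ is a locally asymptotically stable equilibrium of the iteration (A) defined in the context: $\xi^*$ is a fixed point of (A) with associated multiplier $\lambda(\xi^* )=\lambda^*$, and it is locally asymptotically stable for the discrete-time dynamical system (A).
   Context: Setting. Let $n,p,q,n_\theta,N$ be positive integers with $N>n$, and set $\nu=n_\theta+pN$, $m=p(N-n)$. Let $\mathcal{M}:(\mathbb{R}^p)^n\times(\mathbb{R}^q)^{n+1}\times\mathbb{R}^{n_\theta}\to\mathbb{R}^p$ and $\rho:\mathbb{R}^{n_\theta}\to\mathbb{R}$ be twice continuously differentiable, $u_1,\dots,u_N\in\mathbb{R}^q$ given inputs, $\tilde y_1,\dots,\tilde y_N\in\mathbb{R}^p$ given measurements, $W\in\mathbb{R}^{p\times p}$ a positive definite matrix, and $\|\eta\|_W=\sqrt{\eta^\top W\eta}$. Constrained problem (C): over $\xi=[\theta^\top,y_1^\top,\dots,y_N^\top]^\top\in\mathbb{R}^\nu$, minimize $$f(\xi)=\sum_{t=1}^N\|\tilde y_t-y_t\|_W^2+\rho(\theta)$$ subject to $h(\xi)=0$, where $h:\mathbb{R}^\nu\to\mathbb{R}^m$ stacks the blocks $$h_t(\xi)=y_{t+n}-\mathcal{M}(y_{t+n-1},\dots,y_t,u_{t+n},\dots,u_t,\theta)\in\mathbb{R}^p,\qquad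 t=1,\dots,N-n.$$ $J_h(\xi)\in\mathbb{R}^{m\times\nu}$ denotes the Jacobian of $h$. Second-order sufficient conditions of (C) at $(\xi^*,\lambda^* )$: $\nabla f(\xi^* )+J_h(\xi^* )^\top\lambda^*=0$, $h(\xi^* )=0$, and $d^\top\big(\nabla^2 f(\xi^* )+\sum_{i=1}^m\lambda_i^*\nabla^2 h_{(i)}(\xi^* )\big)d>0$ for every $d\in\mathbb{R}^\nu\setminus\{0\}$ with $J_h(\xi^* )d=0$, where $h_{(i)}$ is the $i$-th scalar component of $h$. Iteration (A) (Euler discretization, with step size $\tau>0$, of the feedback-linearization controlled multiplier optimization dynamics with scalar gain $K>0$; stopping criterion disregarded): for $k=0,1,2,\dots$, $$\xi_{k+1}=\xi_k+\tau\big(-\nabla f(\xi_k)-J_h(\xi_k)^\top\lambda(\xi_k)\big),$$ $$\lambda(\xi)=\big(J_h(\xi)J_h(\xi)^\top\big)^{-1}\big(-J_h(\xi)\nabla f(\xi)+K\,h(\xi)\big).$$ (The matrix $J_h(\xi)J_h(\xi)^\top$ is invertible for every $\xi$ for this problem.) Local asymptotic stability of a fixed point is meant in the usual sense: Lyapunov stability, together with convergence to the fixed point of all iterates started sufficiently near it. *)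

theory Defs
  imports "HOL-Analysis.Analysis"
begin

text \<open>
  A finite linearly ordered type \<open>'i\<close> stands for the index set \<open>{1, \<dots>, CARD('i)}\<close>:
  \<open>pos i\<close> is the (1-based) position of \<open>i\<close>, and \<open>slot t\<close> is the index at position \<open>t\<close>
  (unspecified unless \<open>1 \<le> t \<le> CARD('i)\<close>).
\<close>

definition pos :: "'i::{finite,linorder} \<Rightarrow> nat" where
  "pos i = card {..i}"

definition slot :: "nat \<Rightarrow> 'i::{finite,linorder}" where
  "slot = inv pos"

lemma bij_betw_pos: "bij_betw pos (UNIV :: 'i::{finite,linorder} set) {1..CARD('i)}"
proof -
  have less: "pos i < pos j" if "i < j" for i j :: 'i
    unfolding pos_def using that by (intro psubset_card_mono) auto
  then have inj: "inj (pos :: 'i \<Rightarrow> nat)"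
    by (metis injI less_irrefl linorder_neqE)
  have "pos i \<in> {1..CARD('i)}" for i :: 'i
    unfolding pos_def by (auto simp: Suc_le_eq card_gt_0_iff intro!: card_mono)
  then have "range (pos :: 'i \<Rightarrow> nat) = {1..CARD('i)}"
    by (intro card_subset_eq) (auto simp: card_image[OF inj])
  with inj show ?thesis
    by (simp add: bij_betw_def)
qed

lemma slot_pos: "slot (pos i) = i"
  unfolding slot_def by (rule inv_f_f) (rule bij_betw_imp_inj_on[OF bij_betw_pos])

lemma pos_slot: "1 \<le> t \<Longrightarrow> t \<le> CARD('i) \<Longrightarrow> pos (slot t :: 'i::{finite,linorder}) = t"
  using bij_betw_pos[where 'i = 'i] by (auto simp: slot_def bij_betw_def intro!: f_inv_into_f)

definition twice_continuously_differentiable ::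
    "('a::real_normed_vector \<Rightarrow> 'b::real_normed_vector) \<Rightarrow> bool" where
  "twice_continuously_differentiable g \<longleftrightarrow>
     (\<exists>(g' :: 'a \<Rightarrow> ('a \<Rightarrow>\<^sub>L 'b)) (g'' :: 'a \<Rightarrow> ('a \<Rightarrow>\<^sub>L ('a \<Rightarrow>\<^sub>L 'b))).
        (\<forall>x. (g has_derivative blinfun_apply (g' x)) (at x)) \<and>
        (\<forall>x. (g' has_derivative blinfun_apply (g'' x)) (at x)) \<and>
        continuous_on UNIV g'')"

definition grad :: "('a::real_inner \<Rightarrow> real) \<Rightarrow> 'a \<Rightarrow> 'a" where
  "grad g x = (THE D. GDERIV g x :> D)"

definition hessian :: "(real^'v \<Rightarrow> real) \<Rightarrow> real^'v \<Rightarrow> real^'v^'v" where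
  "hessian g x = jacobian (grad g) (at x)"

definition second_order_sufficient ::
    "(real^'v \<Rightarrow> real) \<Rightarrow> (real^'v \<Rightarrow> real^'m) \<Rightarrow> real^'v \<Rightarrow> real^'m \<Rightarrow> bool" where
  "second_order_sufficient f h \<xi> lam \<longleftrightarrow>
     grad f \<xi> + transpose (jacobian h (at \<xi>)) *v lam = 0 \<and>
     h \<xi> = 0 \<and>
     (\<forall>d. d \<noteq> 0 \<longrightarrow> jacobian h (at \<xi>) *v d = 0 \<longrightarrow>
        0 < d \<bullet> ((hessian f \<xi> + (\<Sum>i\<in>UNIV. lam $ i *\<^sub>R hessian (\<lambda>x. h x $ i) \<xi>)) *v d))"

definition fl_multiplier ::
    "real \<Rightarrow> (real^'v \<Rightarrow> real) \<Rightarrow> (real^'v \<Rightarrow> real^'m) \<Rightarrow> real^'v \<Rightarrow> real^'m" where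
  "fl_multiplier K f h \<xi> =
     (let J = jacobian h (at \<xi>)
      in matrix_inv (J ** transpose J) *v (- (J *v grad f \<xi>) + K *\<^sub>R h \<xi>))"

definition fl_step ::
    "real \<Rightarrow> real \<Rightarrow> (real^'v \<Rightarrow> real) \<Rightarrow> (real^'v \<Rightarrow> real^'m) \<Rightarrow> real^'v \<Rightarrow> real^'v" where
  "fl_step \<tau> K f h \<xi> =
     \<xi> + \<tau> *\<^sub>R (- grad f \<xi> - transpose (jacobian h (at \<xi>)) *v fl_multiplier K f h \<xi>)"

definition locally_asymptotically_stable :: "('a::metric_space \<Rightarrow> 'a) \<Rightarrow> 'a \<Rightarrow> bool" where
  "locally_asymptotically_stable T x \<longleftrightarrow>
     T x = x \<and>
     (\<forall>\<epsilon>>0. \<exists>\<delta>>0. \<forall>z. dist z x < \<delta> \<longrightarrow> (\<forall>k. dist ((T ^^ k) z) x < \<epsilon>)) \<and>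
     (\<exists>\<delta>>0. \<forall>z. dist z x < \<delta> \<longrightarrow> (\<lambda>k. (T ^^ k) z) \<longlonglongrightarrow> x)"

text \<open>
  The identification problem. The decision vector stacking \<open>\<theta>, y\<^sub>1, \<dots>, y\<^sub>N\<close> has index type
  \<open>'k + 't \<times> 'p\<close>, where \<open>'k\<close> indexes the components of \<open>\<theta>\<close>, \<open>'t\<close> the time instants
  \<open>1, \<dots>, N\<close>, and \<open>'p\<close> the output components. The constraint vector has index type
  \<open>'s \<times> 'p\<close>, where \<open>'s\<close> indexes the blocks \<open>1, \<dots>, N - n\<close>.
\<close>

definition param_of :: "real^('k::finite + ('t::finite \<times> 'p::finite)) \<Rightarrow> real^'k" where
  "param_of \<xi> = (\<chi> j. \<xi> $ Inl j)"

definition output_of :: "real^('k::finite + ('t::{finite,linorder} \<times> 'p::finite)) \<Rightarrow> nat \<Rightarrow> real^'p" where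
  "output_of \<xi> t = (\<chi> i. \<xi> $ Inr (slot t, i))"

text \<open>Only \<open>x \<bullet> (W *v x) > 0\<close> is required; \<open>W\<close> need not be symmetric.\<close>

definition positive_definite :: "real^'p^'p \<Rightarrow> bool" where
  "positive_definite W \<longleftrightarrow> (\<forall>x. x \<noteq> 0 \<longrightarrow> 0 < x \<bullet> (W *v x))"

definition wnorm :: "real^'p^'p \<Rightarrow> real^'p \<Rightarrow> real" where
  "wnorm W x = sqrt (x \<bullet> (W *v x))"

definition fit_cost ::
    "nat \<Rightarrow> real^'p^'p \<Rightarrow> (nat \<Rightarrow> real^'p) \<Rightarrow> (real^'k \<Rightarrow> real) \<Rightarrow>
     real^('k::finite + ('t::{finite,linorder} \<times> 'p::finite)) \<Rightarrow> real" where
  "fit_cost N W ym \<rho> \<xi> = (\<Sum>t=1..N. (wnorm W (ym t - output_of \<xi> t))\<^sup>2) + \<rho> (param_of \<xi>)"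

text \<open>
  The model takes its past outputs and inputs in reverse chronological order: the arguments are
  \<open>(y\<^bsub>t+n-1\<^esub>, \<dots>, y\<^sub>t)\<close>, indexed by \<open>'l\<close> with \<open>n\<close> elements, and \<open>(u\<^bsub>t+n\<^esub>, \<dots>, u\<^sub>t)\<close>, indexed by
  \<open>'r\<close> with \<open>n + 1\<close> elements.
\<close>

definition model_constraint ::
    "nat \<Rightarrow> (((real^'p)^'l::{finite,linorder}) \<times> ((real^'q)^'r::{finite,linorder}) \<times> (real^'k) \<Rightarrow> real^'p) \<Rightarrow>
     (nat \<Rightarrow> real^'q) \<Rightarrow> real^('k::finite + ('t::{finite,linorder} \<times> 'p::finite)) \<Rightarrow> nat \<Rightarrow> real^'p" where
  "model_constraint n \<M> u \<xi> t =
     output_of \<xi> (t + n)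
     - \<M> (\<chi> j. output_of \<xi> (t + n - pos j), \<chi> j. u (t + n + 1 - pos j), param_of \<xi>)"

definition constraints ::
    "nat \<Rightarrow> (((real^'p)^'l::{finite,linorder}) \<times> ((real^'q)^'r::{finite,linorder}) \<times> (real^'k) \<Rightarrow> real^'p) \<Rightarrow>
     (nat \<Rightarrow> real^'q) \<Rightarrow> real^('k::finite + ('t::{finite,linorder} \<times> 'p::finite)) \<Rightarrow>
     real^('s::{finite,linorder} \<times> 'p::finite)" where
  "constraints n \<M> u \<xi> = (\<chi> c. model_constraint n \<M> u \<xi> (pos (fst c)) $ snd c)"

end

(*
  Write J for the Jacobian of h and F for the right-hand side of the multiplier dynamics.
  By the choice of the multiplier, J F = - K h holds identically.  Differentiating this
  identity and F itself at the equilibrium gives J A = - K J and A = - H - J^T L, where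
  A = DF, H is the Hessian of the Lagrangian and L is the derivative of the multiplier map.
  Hence d.Ad = - d.Hd < 0 on the kernel of J, and for large mu the quadratic form
  |d|^2 + mu |J d|^2 is a strict Lyapunov function of d' = A d; for small step sizes
  it also contracts under the Euler step, and this carries over to the nonlinear iteration.
*)

theory Submission
  imports Defs
begin

subsection \<open>Stability of explicit Euler steps\<close>

text \<open>The norm of \<open>E d\<close> serves as Lyapunov norm; it is equivalent to the given
  norm because \<open>E\<close> is bounded and expansive. If the linear part contracts by
  \<open>q\<close> in it, the margin \<open>1 - q\<close> absorbs the linearization remainder near
  \<open>x\<close>.\<close>

lemma locally_asymptotically_stable_linearization:
  fixes T :: "'a::real_normed_vector \<Rightarrow> 'a" and E :: "'a \<Rightarrow> 'b::real_normed_vector"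
  assumes T: "(T has_derivative M) (at x)" "T x = x"
    and E: "bounded_linear E" "\<And>d. norm d \<le> norm (E d)"
    and M: "\<And>d. norm (E (M d)) \<le> q * norm (E d)" and q: "0 \<le> q" "q < 1"
  shows "locally_asymptotically_stable T x"
proof -
  interpret E: bounded_linear E by (rule E)
  obtain C where C: "C > 0" "\<And>d. norm (E d) \<le> norm d * C"
    using E.pos_bounded by blast
  \<comment> \<open>A remainder of size \<open>e * norm d\<close> grows to at most
    \<open>(1 - q) / 2 * norm d\<close> under \<open>E\<close>. Half of the margin is thus spent,
    and \<open>p\<close> is the midpoint between \<open>q\<close> and 1.\<close>
  define e where "e = (1 - q) / (2 * C)"
  define p where "p = (1 + q) / 2"
  have "e > 0" using q C by (simp add: e_def)
  have p: "0 \<le> p" "p < 1" using q by (auto simp: p_def)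
  obtain r where r: "r > 0" "\<And>z. norm (z - x) < r \<Longrightarrow> norm (T z - T x - M (z - x)) \<le> e * norm (z - x)"
    using T(1) \<open>e > 0\<close> unfolding has_derivative_at_alt by blast
  have step: "norm (E (T z - x)) \<le> p * norm (E (z - x))" if z: "norm (E (z - x)) < r" for z
  proof -
    have zr: "norm (z - x) < r" using z E(2)[of "z - x"] by linarith
    have "E (T z - x) = E (M (z - x)) + E (T z - T x - M (z - x))"
      by (simp add: T(2) flip: E.add)
    then have "norm (E (T z - x)) \<le> norm (E (M (z - x))) + norm (E (T z - T x - M (z - x)))"
      by (simp add: norm_triangle_ineq)
    also have "\<dots> \<le> q * norm (E (z - x)) + (e * norm (z - x)) * C"
      using M[of "z - x"] C(2)[of "T z - T x - M (z - x)"] r(2)[OF zr] C(1)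
      by (smt (verit) mult_right_mono)
    also have "(e * norm (z - x)) * C = (1 - q) / 2 * norm (z - x)"
      using C(1) by (simp add: e_def)
    also have "\<dots> \<le> (1 - q) / 2 * norm (E (z - x))"
      using q E(2) by (intro mult_left_mono) auto
    finally show ?thesis by (simp add: p_def field_simps)
  qed
  have iter: "norm (E ((T ^^ k) z - x)) \<le> p ^ k * norm (E (z - x))" if z: "norm (E (z - x)) < r" for z k
  proof (induction k)
    case (Suc k)
    have "p ^ k * norm (E (z - x)) \<le> 1 * norm (E (z - x))"
      using p by (intro mult_right_mono) (auto intro: power_le_one)
    then have "norm (E ((T ^^ k) z - x)) < r" using Suc z by linarith
    from step[OF this] have "norm (E ((T ^^ Suc k) z - x)) \<le> p * norm (E ((T ^^ k) z - x))" by simp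
    also have "\<dots> \<le> p * (p ^ k * norm (E (z - x)))" using Suc p by (intro mult_left_mono)
    finally show ?case by (simp add: mult.assoc)
  qed simp
  have bound: "dist ((T ^^ k) z) x \<le> p ^ k * (C * dist z x)" if z: "dist z x < r / C" for z k
  proof -
    have "norm (E (z - x)) \<le> C * dist z x" using C(2)[of "z - x"] by (simp add: dist_norm mult.commute)
    moreover have "C * dist z x < r" using z C(1) by (simp add: field_simps)
    ultimately have "norm (E (z - x)) < r" and le: "norm (E (z - x)) \<le> C * dist z x" by linarith+
    from iter[OF this(1), of k] have "norm (E ((T ^^ k) z - x)) \<le> p ^ k * (C * dist z x)"
      using p le by (meson mult_left_mono order_trans zero_le_power)
    then show ?thesis using E(2)[of "(T ^^ k) z - x"] by (simp add: dist_norm)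
  qed
  show ?thesis
    unfolding locally_asymptotically_stable_def
  proof (intro conjI allI impI)
    show "T x = x" by (rule T)
  next
    fix \<epsilon> :: real assume "\<epsilon> > 0"
    show "\<exists>\<delta>>0. \<forall>z. dist z x < \<delta> \<longrightarrow> (\<forall>k. dist ((T ^^ k) z) x < \<epsilon>)"
    proof (intro exI conjI allI impI)
      show "min (r / C) (\<epsilon> / C) > 0" using r C \<open>\<epsilon> > 0\<close> by simp
      fix z k assume z: "dist z x < min (r / C) (\<epsilon> / C)"
      then have "dist ((T ^^ k) z) x \<le> p ^ k * (C * dist z x)" by (intro bound) simp
      also have "\<dots> \<le> 1 * (C * dist z x)"
        using p C(1) by (intro mult_right_mono) (auto intro: power_le_one)
      also have "\<dots> < \<epsilon>" using z C(1) by (simp add: field_simps)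
      finally show "dist ((T ^^ k) z) x < \<epsilon>" .
    qed
  next
    show "\<exists>\<delta>>0. \<forall>z. dist z x < \<delta> \<longrightarrow> (\<lambda>k. (T ^^ k) z) \<longlonglongrightarrow> x"
    proof (intro exI conjI allI impI)
      show "r / C > 0" using r C by simp
      fix z assume z: "dist z x < r / C"
      have "(\<lambda>k. p ^ k * (C * dist z x)) \<longlonglongrightarrow> 0"
        using p by (intro tendsto_mult_left_zero LIMSEQ_realpow_zero)
      then have "(\<lambda>k. dist ((T ^^ k) z) x) \<longlonglongrightarrow> 0"
        by (rule tendsto_sandwich[rotated 3, OF _ ])
           (use bound[OF z] in \<open>auto intro: tendsto_const\<close>)
      then show "(\<lambda>k. (T ^^ k) z) \<longlonglongrightarrow> x" by (rule tendsto_dist_iff[THEN iffD2])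
    qed
  qed
qed

text \<open>A form of Finsler's lemma, by homogeneity and compactness of the unit sphere. Where the
  form of \<open>S\<close> is nonpositive, \<open>C\<close> cannot vanish, so a large multiple of
  the squared norm of \<open>C d\<close> outweighs it; elsewhere the form is already
  positive.\<close>

lemma quadratic_form_augmented_positive:
  fixes S :: "'a::euclidean_space \<Rightarrow> 'a" and C :: "'a \<Rightarrow> 'b::euclidean_space"
  assumes S: "linear S" and C: "linear C"
    and pos: "\<And>d. d \<noteq> 0 \<Longrightarrow> C d = 0 \<Longrightarrow> 0 < d \<bullet> S d"
  obtains \<mu> c where "\<mu> > 0" "c > 0" "\<And>d. c * (norm d)\<^sup>2 \<le> d \<bullet> S d + \<mu> * (norm (C d))\<^sup>2"
proof -
  note bl = S[unfolded linear_conv_bounded_linear] C[unfolded linear_conv_bounded_linear]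
  have contS: "continuous_on X (\<lambda>d. d \<bullet> S d)" and contC: "continuous_on X (\<lambda>d. (norm (C d))\<^sup>2)" for X
    by (intro continuous_intros bounded_linear.continuous_on[OF bl(1)]
        bounded_linear.continuous_on[OF bl(2)])+
  have comp: "compact (sphere (0::'a) 1)" by simp
  have S2: "(r *\<^sub>R d) \<bullet> S (r *\<^sub>R d) = r\<^sup>2 * (d \<bullet> S d)" for r d
    by (simp add: linear_cmul[OF S] power2_eq_square)
  have C2: "(norm (C (r *\<^sub>R d)))\<^sup>2 = r\<^sup>2 * (norm (C d))\<^sup>2" for r d
    by (simp add: linear_cmul[OF C] power_mult_distrib)
  define Z where "Z = sphere (0::'a) 1 \<inter> {d. d \<bullet> S d \<le> 0}"
  have "closed {d. d \<bullet> S d \<le> 0}"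
    using contS[of UNIV] by (intro closed_Collect_le) auto
  then have Z: "compact Z" unfolding Z_def using comp by blast
  obtain \<delta> where \<delta>: "\<delta> > 0" "\<And>d. d \<in> Z \<Longrightarrow> \<delta> \<le> (norm (C d))\<^sup>2"
  proof (cases "Z = {}")
    case True then show ?thesis using that[of 1] by auto
  next
    case False
    then obtain d where d: "d \<in> Z" "\<And>z. z \<in> Z \<Longrightarrow> (norm (C d))\<^sup>2 \<le> (norm (C z))\<^sup>2"
      using continuous_attains_inf[OF Z _ contC] by blast
    have "d \<noteq> 0" "d \<bullet> S d \<le> 0" using d(1) by (auto simp: Z_def)
    then have "C d \<noteq> 0" using pos[of d] by linarith
    then show ?thesis using that[of "(norm (C d))\<^sup>2"] d(2) by auto
  qed
  obtain m where m: "\<And>d. d \<in> sphere 0 1 \<Longrightarrow> m \<le> d \<bullet> S d"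
  proof (cases "sphere (0::'a) 1 = {}")
    case False then show ?thesis using continuous_attains_inf[OF comp _ contS] that by blast
  qed (use that in auto)
  \<comment> \<open>On \<open>Z\<close> the penalty is then at least
    \<open>\<bar>m\<bar> + 1\<close>, which exceeds the deficit allowed by the lower bound
    \<open>m\<close> of the form.\<close>
  define \<mu> where "\<mu> = (\<bar>m\<bar> + 1) / \<delta>"
  have \<mu>: "\<mu> > 0" using \<delta>(1) by (simp add: \<mu>_def)
  let ?Q = "\<lambda>d. d \<bullet> S d + \<mu> * (norm (C d))\<^sup>2"
  have Qpos: "0 < ?Q d" if d: "d \<in> sphere 0 1" for d
  proof (cases "d \<in> Z")
    case True
    have "\<bar>m\<bar> + 1 = \<mu> * \<delta>" using \<delta>(1) by (simp add: \<mu>_def)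
    also have "\<dots> \<le> \<mu> * (norm (C d))\<^sup>2" using \<mu> \<delta>(2)[OF True] by simp
    finally show ?thesis using m[OF d] by linarith
  next
    case False
    then have "d \<bullet> S d > 0" using d by (auto simp: Z_def)
    then show ?thesis using \<mu> by (simp add: add_pos_nonneg)
  qed
  obtain c where c: "c > 0" "\<And>d. d \<in> sphere 0 1 \<Longrightarrow> c \<le> ?Q d"
  proof (cases "sphere (0::'a) 1 = {}")
    case True then show ?thesis using that[of 1] by auto
  next
    case False
    have "continuous_on (sphere 0 1) ?Q" by (intro continuous_intros contS contC)
    then obtain d where "d \<in> sphere 0 1" "\<And>z. z \<in> sphere 0 1 \<Longrightarrow> ?Q d \<le> ?Q z"
      using continuous_attains_inf[OF comp False] by blast
    then show ?thesis using that[of "?Q d"] Qpos by blast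
  qed
  have "c * (norm d)\<^sup>2 \<le> ?Q d" for d
  proof (cases "d = 0")
    case True then show ?thesis by (simp add: linear_0[OF C])
  next
    case False
    define e where "e = (1 / norm d) *\<^sub>R d"
    have e: "e \<in> sphere 0 1" and de: "d = norm d *\<^sub>R e" using False by (auto simp: e_def)
    have "?Q d = (norm d)\<^sup>2 * ?Q e"
      by (subst (1 2 3) de) (simp only: S2 C2 distrib_left mult.left_commute)
    then show ?thesis using mult_left_mono[OF c(2)[OF e], of "(norm d)\<^sup>2"] by (simp add: mult.commute)
  qed
  with \<mu> c(1) show ?thesis by (rule that)
qed

text \<open>The Lyapunov norm is that of the embedding \<open>d \<mapsto> (d, sqrt (\<mu> / K) C d)\<close>.\<close>

lemma euler_step_locally_asymptotically_stable:
  fixes F :: "'a::euclidean_space \<Rightarrow> 'a" and C :: "'a \<Rightarrow> 'b::euclidean_space"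
  assumes F: "(F has_derivative A) (at x)" "F x = 0"
    and C: "linear C" and K: "K > 0"
    and CA: "\<And>d. C (A d) = - K *\<^sub>R C d"
    and pos: "\<And>d. d \<noteq> 0 \<Longrightarrow> C d = 0 \<Longrightarrow> d \<bullet> A d < 0"
  shows "\<exists>\<tau>bar>0. \<forall>\<tau>. 0 < \<tau> \<and> \<tau> < \<tau>bar \<longrightarrow>
           locally_asymptotically_stable (\<lambda>z. z + \<tau> *\<^sub>R F z) x"
proof -
  have A: "linear A" using F(1) by (rule has_derivative_linear)
  obtain \<mu> c where \<mu>: "\<mu> > 0" "c > 0"
    "\<And>d. c * (norm d)\<^sup>2 \<le> d \<bullet> (- A d) + \<mu> * (norm (C d))\<^sup>2"
    using quadratic_form_augmented_positive[OF linear_compose_neg[OF A] C] pos by auto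
  \<comment> \<open>Since \<open>C (A d) = - K *\<^sub>R C d\<close>, the weight
    \<open>\<mu> / K\<close> makes the second component contribute exactly the penalty
    \<open>- \<mu> * (norm (C d))\<^sup>2\<close> to the inner product of \<open>E d\<close> and
    \<open>E (A d)\<close>.\<close>
  define E where "E d = (d, sqrt (\<mu> / K) *\<^sub>R C d)" for d
  have E: "bounded_linear E" unfolding E_def
    using C by (intro bounded_linear_Pair bounded_linear_ident
        bounded_linear_scaleR_right[THEN bounded_linear_compose])
      (simp add: linear_conv_bounded_linear)
  interpret E: bounded_linear E by (rule E)
  have E_ge: "norm d \<le> norm (E d)" for d
    by (simp add: E_def norm_Pair real_le_rsqrt)
  have EA: "E d \<bullet> E (A d) \<le> - (c * (norm d)\<^sup>2)" for d
  proof -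
    have "E d \<bullet> E (A d) = d \<bullet> A d + \<mu> / K * (C d \<bullet> C (A d))"
      using \<mu>(1) K by (simp add: E_def flip: mult.assoc)
    also have "\<dots> = d \<bullet> A d - \<mu> * (norm (C d))\<^sup>2"
      using K by (simp add: CA power2_norm_eq_inner)
    finally show ?thesis using \<mu>(3)[of d] by simp
  qed
  obtain D where D: "D > 0" "\<And>d. norm (E d) \<le> norm d * D" using E.pos_bounded by blast
  have "bounded_linear (\<lambda>d. E (A d))"
    using E A by (intro bounded_linear_compose[OF E]) (simp add: linear_conv_bounded_linear)
  then obtain B where B: "B > 0" "\<And>d. norm (E (A d)) \<le> norm d * B"
    using bounded_linear.pos_bounded by blast
  \<comment> \<open>The first bound lets the term quadratic in \<tau> consume at most half of the
    decrease \<open>2 * \<tau> * c * (norm d)\<^sup>2\<close>. The second keeps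
    \<open>1 - \<tau> * c / D\<^sup>2\<close> nonnegative, so that its root can be the contraction
    factor.\<close>
  define \<tau>bar where "\<tau>bar = min (c / B\<^sup>2) (D\<^sup>2 / c)"
  have "locally_asymptotically_stable (\<lambda>z. z + \<tau> *\<^sub>R F z) x" if \<tau>: "0 < \<tau>" "\<tau> < \<tau>bar" for \<tau>
  proof (rule locally_asymptotically_stable_linearization[where E = E and
        M = "\<lambda>d. d + \<tau> *\<^sub>R A d" and q = "sqrt (1 - \<tau> * c / D\<^sup>2)"])
    show "((\<lambda>z. z + \<tau> *\<^sub>R F z) has_derivative (\<lambda>d. d + \<tau> *\<^sub>R A d)) (at x)"
      by (intro derivative_intros F)
    have \<tau>1: "\<tau> * B\<^sup>2 \<le> c" using \<tau> B(1) by (simp add: \<tau>bar_def field_simps)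
    have \<tau>2: "\<tau> * c / D\<^sup>2 \<le> 1" using \<tau> D(1) \<mu>(2) by (simp add: \<tau>bar_def field_simps)
    show "0 \<le> sqrt (1 - \<tau> * c / D\<^sup>2)" using \<tau>2 by simp
    show "sqrt (1 - \<tau> * c / D\<^sup>2) < 1" using \<tau> D(1) \<mu>(2) by simp
    show "norm (E (d + \<tau> *\<^sub>R A d)) \<le> sqrt (1 - \<tau> * c / D\<^sup>2) * norm (E d)" for d
    proof (rule power2_le_imp_le)
      have "(norm (E (d + \<tau> *\<^sub>R A d)))\<^sup>2
          = (norm (E d))\<^sup>2 + 2 * \<tau> * (E d \<bullet> E (A d)) + \<tau>\<^sup>2 * (norm (E (A d)))\<^sup>2"
        unfolding power2_norm_eq_inner E.add E.scaleR
        by (simp add: inner_simps inner_commute power2_eq_square algebra_simps)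
      also have "\<dots> \<le> (norm (E d))\<^sup>2 + 2 * \<tau> * (- (c * (norm d)\<^sup>2)) + \<tau>\<^sup>2 * (norm d * B)\<^sup>2"
        using \<tau>(1) EA[of d] B(2)[of d] by (intro add_mono mult_left_mono power_mono) auto
      also have "\<tau>\<^sup>2 * (norm d * B)\<^sup>2 = \<tau> * (norm d)\<^sup>2 * (\<tau> * B\<^sup>2)"
        by (simp add: power2_eq_square)
      also have "\<dots> \<le> \<tau> * (norm d)\<^sup>2 * c"
        using \<tau>1 \<tau>(1) by (intro mult_left_mono) auto
      finally have le: "(norm (E (d + \<tau> *\<^sub>R A d)))\<^sup>2 \<le> (norm (E d))\<^sup>2 - \<tau> * c * (norm d)\<^sup>2"
        by (simp add: algebra_simps)
      \<comment> \<open>The decrease is so far measured by \<open>norm d\<close>; the bound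
        \<open>D\<close> of \<open>E\<close> turns it into a fixed fraction of the Lyapunov
        norm.\<close>
      have "(norm (E d))\<^sup>2 \<le> (norm d * D)\<^sup>2" using D(2)[of d] by (intro power_mono) auto
      then have "(norm (E d))\<^sup>2 / D\<^sup>2 \<le> (norm d)\<^sup>2"
        using D(1) by (simp add: field_simps)
      then have "\<tau> * c * ((norm (E d))\<^sup>2 / D\<^sup>2) \<le> \<tau> * c * (norm d)\<^sup>2"
        using \<tau>(1) \<mu>(2) by (intro mult_left_mono) auto
      with le have "(norm (E (d + \<tau> *\<^sub>R A d)))\<^sup>2 \<le> (1 - \<tau> * c / D\<^sup>2) * (norm (E d))\<^sup>2"
        by (simp add: algebra_simps)
      then show "(norm (E (d + \<tau> *\<^sub>R A d)))\<^sup>2 \<le> (sqrt (1 - \<tau> * c / D\<^sup>2) * norm (E d))\<^sup>2"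
        using \<tau>2 by (simp add: power_mult_distrib)
    qed (use \<tau>2 in simp)
  qed (use F(2) E E_ge in auto)
  moreover have "\<tau>bar > 0" using \<mu>(2) B(1) D(1) by (simp add: \<tau>bar_def)
  ultimately show ?thesis by blast
qed

subsection \<open>Componentwise differentiation\<close>

lemma has_derivative_vecI:
  fixes f :: "'a::real_normed_vector \<Rightarrow> 'b::euclidean_space^'n"
  assumes "\<And>i. ((\<lambda>x. f x $ i) has_derivative (\<lambda>d. D d $ i)) (at x)"
  shows "(f has_derivative D) (at x)"
  unfolding has_derivative_componentwise_within[of f]
  by (auto simp: Basis_vec_def inner_axis intro!: has_derivative_inner_left assms)

lemma differentiable_vec_nth_iff:
  fixes f :: "'a::real_normed_vector \<Rightarrow> 'b::euclidean_space^'n"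
  shows "f differentiable (at x) \<longleftrightarrow> (\<forall>i. (\<lambda>x. f x $ i) differentiable (at x))"
proof
  assume "f differentiable (at x)"
  then show "\<forall>i. (\<lambda>x. f x $ i) differentiable (at x)"
    unfolding differentiable_def by (blast intro: bounded_linear.has_derivative[OF bounded_linear_vec_nth])
next
  assume "\<forall>i. (\<lambda>x. f x $ i) differentiable (at x)"
  then obtain D where D: "\<And>i. ((\<lambda>x. f x $ i) has_derivative D i) (at x)"
    unfolding differentiable_def by metis
  have "(f has_derivative (\<lambda>d. \<chi> i. D i d)) (at x)"
    by (rule has_derivative_vecI) (simp add: D)
  then show "f differentiable (at x)" by (rule differentiableI)
qed

lemma differentiable_vec_nth:
  fixes f :: "'a::real_normed_vector \<Rightarrow> 'b::euclidean_space^'n"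
  shows "f differentiable (at x) \<Longrightarrow> (\<lambda>x. f x $ i) differentiable (at x)"
  by (simp add: differentiable_vec_nth_iff)

section \<open>Determinants and solutions of linear systems\<close>

lemma differentiable_prod:
  fixes f :: "'i \<Rightarrow> 'a::real_normed_vector \<Rightarrow> 'b::real_normed_field"
  assumes "\<And>i. i \<in> I \<Longrightarrow> f i differentiable (at x)"
  shows "(\<lambda>x. \<Prod>i\<in>I. f i x) differentiable (at x)"
  using assms
proof (induction I rule: infinite_finite_induct)
  case (insert i I)
  then show ?case by (auto intro!: differentiable_mult)
qed auto

lemma differentiable_det:
  fixes G :: "'a::real_normed_vector \<Rightarrow> real^'n^'n"
  assumes "\<And>i j. (\<lambda>x. G x $ i $ j) differentiable (at x)"
  shows "(\<lambda>x. det (G x)) differentiable (at x)"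
  unfolding det_def
  by (intro differentiable_sum differentiable_mult differentiable_prod differentiable_const assms ballI)
     (auto simp: finite_permutations assms intro: differentiable_prod)

text \<open>Cramer's rule writes each component of \<open>y\<close> as a quotient of determinants,
  polynomials in the entries of \<open>G\<close> and \<open>b\<close>. Applied to the Gram matrix of
  the constraint Jacobian, this differentiates the multiplier map.\<close>

lemma differentiable_linear_system_solution:
  fixes G :: "'a::real_normed_vector \<Rightarrow> real^'n^'n" and y :: "'a \<Rightarrow> real^'n"
  assumes G: "G differentiable (at x)" and b: "b differentiable (at x)"
    and nz: "\<And>z. det (G z) \<noteq> 0" and y: "\<And>z. G z *v y z = b z"
  shows "y differentiable (at x)"
proof -
  have "y = (\<lambda>z. \<chi> k. det (\<chi> i j. if j = k then b z $ i else G z $ i $ j) / det (G z))"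
    using cramer[OF nz] y by blast
  moreover have "(\<lambda>z. if j = k then b z $ i else G z $ i $ j) differentiable (at x)" for i j k
    using differentiable_vec_nth[OF b] differentiable_vec_nth[OF differentiable_vec_nth[OF G]]
    by (cases "j = k") auto
  ultimately show ?thesis
    using nz differentiable_vec_nth[OF differentiable_vec_nth[OF G]]
    by (auto simp: differentiable_vec_nth_iff intro!: differentiable_divide differentiable_det)
qed

text \<open>Resolves the definite description in \<open>grad\<close>: the values of \<open>D\<close>
  on the unit vectors form its Riesz representative, and uniqueness follows from uniqueness of the
  derivative.\<close>

lemma grad_eq:
  fixes f :: "real^'v \<Rightarrow> real"
  assumes "(f has_derivative D) (at x)"
  shows "grad f x = (\<chi> j. D (axis j 1))"
proof -
  have lin: "linear D" using assms by (rule has_derivative_linear)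
  have "D d = d \<bullet> (\<chi> j. D (axis j 1))" for d
  proof -
    have "D d = D (\<Sum>j\<in>UNIV. (d $ j) *\<^sub>R axis j 1)"
      using basis_expansion[of d] by (simp add: scalar_mult_eq_scaleR)
    also have "\<dots> = d \<bullet> (\<chi> j. D (axis j 1))"
      by (simp add: linear_sum[OF lin] linear_cmul[OF lin] inner_vec_def)
    finally show ?thesis .
  qed
  then have *: "(\<lambda>d. d \<bullet> (\<chi> j. D (axis j 1))) = D" by (intro ext) (rule sym)
  have G: "GDERIV f x :> (\<chi> j. D (axis j 1))"
    unfolding gderiv_def * by (rule assms)
  have "E = (\<chi> j. D (axis j 1))" if "GDERIV f x :> E" for E
  proof -
    have "(\<lambda>d. d \<bullet> E) = (\<lambda>d. d \<bullet> (\<chi> j. D (axis j 1)))"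
      using that G unfolding gderiv_def by (rule has_derivative_unique)
    then show ?thesis by (metis vector_eq_ldot)
  qed
  then show ?thesis unfolding grad_def by (rule the_equality[where P = "\<lambda>D. GDERIV f x :> D", OF G])
qed

lemma jacobian_nth:
  fixes h :: "real^'v \<Rightarrow> real^'m"
  assumes "(h has_derivative D) (at x)"
  shows "jacobian h (at x) $ i $ j = D (axis j 1) $ i"
  using frechet_derivative_at[OF assms] by (simp add: jacobian_def matrix_def)

text \<open>Provides the product rule for the multiplier term, where the transposed Jacobian applied
  to a vector is written as \<open>v v* A\<close>.\<close>

lemma bounded_bilinear_vector_matrix_mult:
  "bounded_bilinear (\<lambda>(v::real^'m) (A::real^'n^'m). v v* A)"
  unfolding bilinear_conv_bounded_bilinear[symmetric] bilinear_def
  by (auto intro!: linearI simp: vector_matrix_left_distrib vector_matrix_mult_add_rdistrib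
      scaleR_vector_matrix_assoc vector_scaleR_matrix_ac)

lemma bounded_bilinear_matrix_vector_mult:
  "bounded_bilinear (\<lambda>(A::real^'n^'m) (v::real^'n). A *v v)"
  unfolding bilinear_conv_bounded_bilinear[symmetric] bilinear_def
  by (auto intro!: linearI simp: matrix_vector_mult_add_rdistrib scaleR_matrix_vector_assoc)

subsection \<open>Feedback-linearized multiplier dynamics\<close>

text \<open>Isolates what a concrete problem must supply. Full row rank is asked at every point so
  that the closed-loop identity \<open>J x *v F x = - K *\<^sub>R h x\<close> holds everywhere and
  may be differentiated.\<close>

lemma fl_step_locally_asymptotically_stable:
  fixes f :: "real^'v \<Rightarrow> real" and h :: "real^'v \<Rightarrow> real^'m"
  assumes dg: "grad f differentiable (at \<xi>)"
    and dh: "\<And>x. h differentiable (at x)"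
    and dJ: "(\<lambda>x. jacobian h (at x)) differentiable (at \<xi>)"
    and full_rank: "\<And>x w. w v* jacobian h (at x) = 0 \<Longrightarrow> w = 0"
    and K: "0 < K"
    and sosc: "second_order_sufficient f h \<xi> lam"
  shows "\<exists>\<tau>bar>0. \<forall>\<tau>. 0 < \<tau> \<and> \<tau> < \<tau>bar \<longrightarrow>
           fl_step \<tau> K f h \<xi> = \<xi> \<and>
           fl_multiplier K f h \<xi> = lam \<and>
           locally_asymptotically_stable (fl_step \<tau> K f h) \<xi>"
proof -
  define J where "J x = jacobian h (at x)" for x
  define G where "G x = J x ** transpose (J x)" for x
  define l where "l = fl_multiplier K f h"
  define F where "F x = - grad f x - l x v* J x" for x
  have step: "fl_step \<tau> K f h = (\<lambda>z. z + \<tau> *\<^sub>R F z)" for \<tau>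
    by (auto simp: fl_step_def F_def l_def J_def)
  have Gv: "G x *v w = J x *v (w v* J x)" for x w
    by (simp add: G_def flip: matrix_vector_mul_assoc)
  \<comment> \<open>\<open>G\<close> is the Gram matrix of the rows of the Jacobian: its quadratic
    form is the squared norm of \<open>w v* J x\<close>, so full row rank gives a trivial
    kernel.\<close>
  have G0: "w = 0" if "G x *v w = 0" for x w
  proof -
    have "(w v* J x) \<bullet> (w v* J x) = w \<bullet> (G x *v w)"
      by (simp add: Gv dot_lmul_matrix)
    then show ?thesis using that full_rank[of w x] by (simp add: J_def)
  qed
  then have inv: "invertible (G x)" for x
    unfolding invertible_left_inverse matrix_left_invertible_ker by blast
  have G_inv: "G x ** matrix_inv (G x) = mat 1" for x
    using inv[of x] unfolding invertible_def matrix_inv_def by (rule someI2_ex) blast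
  have Gl: "G x *v l x = - (J x *v grad f x) + K *\<^sub>R h x" for x
    using G_inv[of x]
    by (simp add: l_def fl_multiplier_def Let_def matrix_vector_mul_assoc
        flip: J_def G_def)
  \<comment> \<open>Feedback linearization: the multiplier cancels the gradient's effect on the
    constraints and leaves a linear decay of \<open>h\<close> along \<open>F\<close>.\<close>
  have JF: "J x *v F x = - K *\<^sub>R h x" for x
    using Gl[of x] by (simp add: F_def Gv matrix_vector_mult_diff_distrib vec.neg)
  have stat: "grad f \<xi> + lam v* J \<xi> = 0" and h0: "h \<xi> = 0"
    using sosc by (auto simp: second_order_sufficient_def J_def)
  \<comment> \<open>As \<open>h\<close> vanishes at \<xi>, stationarity makes \<open>lam\<close> a
    solution of the same Gram system as \<open>l \<xi>\<close>; the trivial kernel identifies the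
    two.\<close>
  have "G \<xi> *v lam = - (J \<xi> *v grad f \<xi>)"
  proof -
    have "lam v* J \<xi> = - grad f \<xi>" using stat by (metis add.commute eq_neg_iff_add_eq_0)
    then show ?thesis by (simp add: Gv vec.neg)
  qed
  then have "G \<xi> *v (l \<xi> - lam) = 0"
    using Gl[of \<xi>] h0 by (simp add: matrix_vector_mult_diff_distrib)
  then have l\<xi>: "l \<xi> = lam" using G0[of \<xi> "l \<xi> - lam"] by simp
  have F\<xi>: "F \<xi> = 0" using stat by (simp add: F_def l\<xi> neg_eq_iff_add_eq_0)

  \<comment> \<open>Linearization of the closed loop at the equilibrium\<close>
  obtain Dg where Dg: "(grad f has_derivative Dg) (at \<xi>)"
    using dg unfolding differentiable_def by blast
  obtain DJ where DJ: "(J has_derivative DJ) (at \<xi>)"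
    using dJ unfolding differentiable_def J_def by blast
  have Dh: "(h has_derivative (\<lambda>d. J x *v d)) (at x)" for x
    using dh[of x] unfolding J_def jacobian_works .
  note vm = bounded_bilinear.FDERIV[OF bounded_bilinear_vector_matrix_mult]
  note mv = bounded_bilinear.FDERIV[OF bounded_bilinear_matrix_vector_mult]
  have "((\<lambda>x. - (J x *v grad f x) + K *\<^sub>R h x) has_derivative
      (\<lambda>d. - (J \<xi> *v Dg d + DJ d *v grad f \<xi>) + K *\<^sub>R (J \<xi> *v d))) (at \<xi>)"
    by (intro has_derivative_add has_derivative_minus has_derivative_scaleR_right mv[OF DJ Dg] Dh)
  then have db: "(\<lambda>x. - (J x *v grad f x) + K *\<^sub>R h x) differentiable (at \<xi>)"
    by (rule differentiableI)
  have dG: "G differentiable (at \<xi>)"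
  proof -
    have "(\<lambda>x. J x $ i $ j) differentiable (at \<xi>)" for i j
      unfolding J_def by (intro differentiable_vec_nth dJ)
    then have "(\<lambda>x. \<Sum>k\<in>UNIV. J x $ i $ k * J x $ j $ k) differentiable (at \<xi>)" for i j
      by (intro differentiable_sum ballI differentiable_mult) auto
    then have "(\<lambda>x. G x $ i $ j) differentiable (at \<xi>)" for i j
      by (simp add: G_def matrix_matrix_mult_def transpose_def)
    then have "\<And>i. (\<lambda>x. G x $ i) differentiable (at \<xi>)"
      by (rule differentiable_vec_nth_iff[THEN iffD2, rule_format])
    then show ?thesis
      by (rule differentiable_vec_nth_iff[THEN iffD2, rule_format])
  qed
  have "l differentiable (at \<xi>)"
    using inv by (intro differentiable_linear_system_solution[OF dG db _ Gl]) (simp add: invertible_det_nz)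
  then obtain L where L: "(l has_derivative L) (at \<xi>)"
    unfolding differentiable_def by blast
  define A where "A d = - Dg d - (lam v* DJ d + L d v* J \<xi>)" for d
  have DF: "(F has_derivative A) (at \<xi>)"
    unfolding F_def A_def using vm[OF L DJ] l\<xi>
    by (intro has_derivative_diff has_derivative_minus Dg) simp

  \<comment> \<open>The product is differentiated in two ways. In the product rule the term with
    \<open>DJ\<close> drops out because \<open>F \<xi> = 0\<close>; the other derivative comes from
    \<open>JF\<close>.\<close>
  have "((\<lambda>x. J x *v F x) has_derivative (\<lambda>d. J \<xi> *v A d)) (at \<xi>)"
    using mv[OF DJ DF] by (simp add: F\<xi>)
  moreover have "((\<lambda>x. J x *v F x) has_derivative (\<lambda>d. - K *\<^sub>R (J \<xi> *v d))) (at \<xi>)"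
    unfolding JF by (intro has_derivative_scaleR_right Dh)
  ultimately have "(\<lambda>d. J \<xi> *v A d) = (\<lambda>d. - K *\<^sub>R (J \<xi> *v d))"
    by (rule has_derivative_unique)
  then have JA: "J \<xi> *v A d = - K *\<^sub>R (J \<xi> *v d)" for d by metis

  \<comment> \<open>Hessian of the Lagrangian and the sign of the linearization\<close>
  have hess_f: "hessian f \<xi> *v d = Dg d" for d
    using Dg frechet_derivative_at[OF Dg]
    by (simp add: hessian_def jacobian_def has_derivative_linear)
  \<comment> \<open>The gradient of the \<open>i\<close>-th constraint is the \<open>i\<close>-th
    row of the Jacobian, at every point, so its Hessian is the derivative of that row.\<close>
  have hess_h: "hessian (\<lambda>x. h x $ i) \<xi> *v d = DJ d $ i" for i d
  proof -
    have "grad (\<lambda>x. h x $ i) = (\<lambda>x. J x $ i)"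
    proof
      fix x
      have "((\<lambda>x. h x $ i) has_derivative (\<lambda>d. (J x *v d) $ i)) (at x)"
        using Dh by (rule bounded_linear.has_derivative[OF bounded_linear_vec_nth])
      from grad_eq[OF this] show "grad (\<lambda>x. h x $ i) x = J x $ i"
        by (simp add: vec_eq_iff matrix_vector_mult_basis column_def)
    qed
    then have D: "(grad (\<lambda>x. h x $ i) has_derivative (\<lambda>d. DJ d $ i)) (at \<xi>)"
      using bounded_linear.has_derivative[OF bounded_linear_vec_nth DJ] by simp
    show ?thesis
      using D frechet_derivative_at[OF D, symmetric]
      by (simp add: hessian_def jacobian_def has_derivative_linear)
  qed
  have hess: "(hessian f \<xi> + (\<Sum>i\<in>UNIV. lam $ i *\<^sub>R hessian (\<lambda>x. h x $ i) \<xi>)) *v d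
      = Dg d + lam v* DJ d" for d
  proof -
    have "(\<Sum>i\<in>UNIV. lam $ i *\<^sub>R hessian (\<lambda>x. h x $ i) \<xi>) *v d
        = (\<Sum>i\<in>UNIV. (lam $ i *\<^sub>R hessian (\<lambda>x. h x $ i) \<xi>) *v d)"
      by (rule bounded_bilinear.sum_left[OF bounded_bilinear_matrix_vector_mult])
    also have "\<dots> = (\<Sum>i\<in>UNIV. lam $ i *\<^sub>R DJ d $ i)"
      by (simp add: hess_h scaleR_matrix_vector_assoc[symmetric])
    also have "\<dots> = lam v* DJ d"
      by (simp add: vec_eq_iff vector_matrix_mult_def)
    finally show ?thesis by (simp add: matrix_vector_mult_add_rdistrib hess_f)
  qed
  have neg: "d \<bullet> A d < 0" if d: "d \<noteq> 0" "J \<xi> *v d = 0" for d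
  proof -
    have "0 < d \<bullet> (Dg d + lam v* DJ d)"
      using sosc d by (simp add: second_order_sufficient_def J_def hess)
    \<comment> \<open>The variation of the multiplier lies in the row space of the Jacobian,
      orthogonal to its kernel; only the Hessian of the Lagrangian remains.\<close>
    moreover have "(L d v* J \<xi>) \<bullet> d = 0" by (simp add: dot_lmul_matrix d)
    ultimately show ?thesis by (simp add: A_def inner_simps inner_commute)
  qed
  have "\<exists>\<tau>bar>0. \<forall>\<tau>. 0 < \<tau> \<and> \<tau> < \<tau>bar \<longrightarrow>
      locally_asymptotically_stable (\<lambda>z. z + \<tau> *\<^sub>R F z) \<xi>"
    by (rule euler_step_locally_asymptotically_stable[where C = "(*v) (J \<xi>)", OF DF F\<xi> _ K JA neg]) auto
  then show ?thesis
    using l\<xi> F\<xi> by (simp add: step l_def)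
qed

subsection \<open>The identification problem\<close>

lemma bounded_linear_output_of:
  "bounded_linear (\<lambda>\<xi>::real^('k::finite + ('t::{finite,linorder} \<times> 'p::finite)). output_of \<xi> t)"
  unfolding linear_conv_bounded_linear[symmetric]
  by (rule linearI) (simp_all add: output_of_def vec_eq_iff)

lemma bounded_linear_param_of:
  "bounded_linear (param_of :: real^('k::finite + ('t::{finite,linorder} \<times> 'p::finite)) \<Rightarrow> real^'k)"
  unfolding linear_conv_bounded_linear[symmetric]
  by (rule linearI) (simp_all add: param_of_def vec_eq_iff)

lemmas output_of_derivative = bounded_linear.has_derivative[OF bounded_linear_output_of has_derivative_ident]
lemmas param_of_derivative = bounded_linear.has_derivative[OF bounded_linear_param_of has_derivative_ident]

section \<open>Differentiability of the gradient of the cost\<close>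

lemma twice_continuously_differentiableE:
  assumes "twice_continuously_differentiable g"
  obtains g' where "\<And>x. (g has_derivative blinfun_apply (g' x)) (at x)"
    and "\<And>x. g' differentiable (at x)"
  using assms unfolding twice_continuously_differentiable_def differentiable_def by metis

lemma differentiable_blinfun_apply:
  assumes "B differentiable (at (a x))" and "a differentiable (at x)"
  shows "(\<lambda>x. blinfun_apply (B (a x)) v) differentiable (at x)"
proof -
  have "(\<lambda>x. B (a x)) differentiable (at x)"
    using differentiable_chain_at[of a x B] assms by (simp add: o_def)
  then obtain D where "((\<lambda>x. B (a x)) has_derivative D) (at x)"
    unfolding differentiable_def by blast
  then have "((\<lambda>x. blinfun_apply (B (a x)) v) has_derivative (\<lambda>d. blinfun_apply (D d) v)) (at x)"
    by (rule bounded_linear.has_derivative[OF blinfun.bounded_linear_left])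
  then show ?thesis by (rule differentiableI)
qed

lemma grad_fit_cost_differentiable:
  fixes \<rho> :: "real^'k \<Rightarrow> real" and \<xi> :: "real^('k::finite + ('t::{finite,linorder} \<times> 'p::finite))"
  assumes \<rho>: "twice_continuously_differentiable \<rho>" and W: "positive_definite W"
  shows "grad (fit_cost N W ym \<rho> :: real^('k + ('t \<times> 'p)) \<Rightarrow> real) differentiable (at \<xi>)"
proof -
  obtain \<rho>' where \<rho>': "\<And>x. (\<rho> has_derivative blinfun_apply (\<rho>' x)) (at x)"
    "\<And>x. \<rho>' differentiable (at x)"
    using \<rho> by (rule twice_continuously_differentiableE) blast
  let ?f = "fit_cost N W ym \<rho> :: real^('k + ('t \<times> 'p)) \<Rightarrow> real"
  define r where "r x t = ym t - output_of x t" for x :: "real^('k + ('t \<times> 'p))" and t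
  \<comment> \<open>Both terms of the product rule are kept, since \<open>W\<close> may be
    nonsymmetric.\<close>
  define D where "D x d = (\<Sum>t=1..N. r x t \<bullet> (W *v (- output_of d t)) + (- output_of d t) \<bullet> (W *v r x t))
      + blinfun_apply (\<rho>' (param_of x)) (param_of d)" for x d :: "real^('k + ('t \<times> 'p))"
  have dr: "((\<lambda>x. r x t) has_derivative (\<lambda>d. - output_of d t)) (at x)" for t x
    unfolding r_def using has_derivative_diff[OF has_derivative_const output_of_derivative] by simp
  have dWr: "((\<lambda>x. W *v r x t) has_derivative (\<lambda>d. W *v (- output_of d t))) (at x)" for t x
    by (rule bounded_linear.has_derivative[OF matrix_vector_mul_bounded_linear dr])
  \<comment> \<open>Nonnegativity lets the square cancel the root in \<open>wnorm\<close>, so the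
    cost is a quadratic form in the residuals, smooth also where a residual vanishes.\<close>
  have "x \<bullet> (W *v x) \<ge> 0" for x
    using W by (cases "x = 0") (auto simp: positive_definite_def less_imp_le)
  then have f: "?f = (\<lambda>x. (\<Sum>t=1..N. r x t \<bullet> (W *v r x t)) + \<rho> (param_of x))"
    by (simp add: fit_cost_def wnorm_def r_def fun_eq_iff)
  have "((\<lambda>x. \<rho> (param_of x)) has_derivative (\<lambda>d. blinfun_apply (\<rho>' (param_of x)) (param_of d))) (at x)"
    for x :: "real^('k + ('t \<times> 'p))"
    by (rule has_derivative_compose[OF param_of_derivative \<rho>'(1)])
  then have "(?f has_derivative D x) (at x)" for x
    unfolding f D_def by (intro has_derivative_add has_derivative_sum has_derivative_inner dr dWr)
  then have "grad ?f = (\<lambda>x. \<chi> j. D x (axis j 1))"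
    by (intro ext grad_eq)
  moreover have "(\<lambda>x. D x d) differentiable (at \<xi>)" for d
    unfolding D_def
    by (intro differentiable_add differentiable_sum ballI differentiable_inner differentiable_const
        differentiable_blinfun_apply \<rho>' differentiableI[OF dr] differentiableI[OF dWr]
        differentiableI[OF param_of_derivative]) auto
  ultimately show ?thesis by (simp add: differentiable_vec_nth_iff)
qed

section \<open>Derivative and rank of the constraint map\<close>

definition model_args ::
    "nat \<Rightarrow> (nat \<Rightarrow> real^'q) \<Rightarrow> nat \<Rightarrow> real^('k::finite + ('t::{finite,linorder} \<times> 'p::finite)) \<Rightarrow>
     ((real^'p)^'l::{finite,linorder}) \<times> ((real^'q)^'r::{finite,linorder}) \<times> (real^'k)" where
  "model_args n u t \<xi> = (\<chi> j. output_of \<xi> (t + n - pos j), \<chi> j. u (t + n + 1 - pos j), param_of \<xi>)"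

text \<open>The model's argument is affine in the decision vector: outputs and parameters vary
  linearly, while the given inputs contribute \<open>0\<close>.\<close>

lemma model_args_has_derivative:
  "(model_args n u t has_derivative (\<lambda>d. (\<chi> j. output_of d (t + n - pos j), 0, param_of d))) (at \<xi>)"
proof -
  have "((\<lambda>x. \<chi> j. output_of x (t + n - pos j)) has_derivative
      (\<lambda>d. \<chi> j. output_of d (t + n - pos j))) (at \<xi>)"
    by (rule has_derivative_vecI) (simp add: output_of_derivative)
  then show ?thesis
    unfolding model_args_def
    by (intro has_derivative_Pair has_derivative_const param_of_derivative)
qed

lemma constraints_has_derivative:
  fixes \<M> :: "((real^'p)^'l::{finite,linorder}) \<times> ((real^'q)^'r::{finite,linorder}) \<times> (real^'k) \<Rightarrow> real^'p"
    and \<xi> :: "real^('k::finite + ('t::{finite,linorder} \<times> 'p::finite))"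
  assumes \<M>': "\<And>z. (\<M> has_derivative blinfun_apply (\<M>' z)) (at z)"
  shows "((constraints n \<M> u :: _ \<Rightarrow> real^('s::{finite,linorder} \<times> 'p)) has_derivative
      (\<lambda>d. \<chi> c. output_of d (pos (fst c) + n) $ snd c
        - blinfun_apply (\<M>' (model_args n u (pos (fst c)) \<xi>))
            (\<chi> j. output_of d (pos (fst c) + n - pos j), 0, param_of d) $ snd c)) (at \<xi>)"
proof (rule has_derivative_vecI)
  fix c :: "'s \<times> 'p"
  let ?t = "pos (fst c)"
  have nth: "((\<lambda>x. g x $ i) has_derivative (\<lambda>d. g' d $ i)) (at \<xi>)"
    if "(g has_derivative g') (at \<xi>)" for g :: "real^('k + ('t \<times> 'p)) \<Rightarrow> real^'p" and g' i
    using that by (rule bounded_linear.has_derivative[OF bounded_linear_vec_nth])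
  have "((\<lambda>x. \<M> (model_args n u ?t x)) has_derivative
      (\<lambda>d. blinfun_apply (\<M>' (model_args n u ?t \<xi>)) (\<chi> j. output_of d (?t + n - pos j), 0, param_of d))) (at \<xi>)"
    by (rule has_derivative_compose[OF model_args_has_derivative \<M>'])
  from has_derivative_diff[OF nth[OF output_of_derivative] nth[OF this]]
  show "((\<lambda>x. (constraints n \<M> u x :: real^('s \<times> 'p)) $ c) has_derivative
      (\<lambda>d. (\<chi> c. output_of d (pos (fst c) + n) $ snd c
        - blinfun_apply (\<M>' (model_args n u (pos (fst c)) \<xi>))
            (\<chi> j. output_of d (pos (fst c) + n - pos j), 0, param_of d) $ snd c) $ c)) (at \<xi>)"
    by (simp add: constraints_def model_constraint_def model_args_def)
qed

text \<open>The block \<open>h\<^sub>t\<close> contains \<open>y\<^bsub>t+n\<^esub>\<close> with coefficient one, and the earlier blocks do not contain it: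
  testing against \<open>y\<^bsub>t+n\<^esub>\<close> isolates the last nonzero entry of \<open>w\<close>.\<close>

lemma constraints_jacobian_full_rank:
  fixes \<M> :: "((real^'p)^'l::{finite,linorder}) \<times> ((real^'q)^'r::{finite,linorder}) \<times> (real^'k) \<Rightarrow> real^'p"
    and w :: "real^('s::{finite,linorder} \<times> 'p)"
  assumes \<M>: "twice_continuously_differentiable \<M>"
    and card: "CARD('l) = n" "CARD('t::{finite,linorder}) = N" "CARD('s) = N - n"
    and w: "w v* jacobian (constraints n \<M> u :: real^('k::finite + ('t \<times> 'p::finite)) \<Rightarrow> real^('s \<times> 'p)) (at x) = 0"
  shows "w = 0"
proof (rule ccontr)
  let ?h = "constraints n \<M> u :: real^('k + ('t \<times> 'p)) \<Rightarrow> real^('s \<times> 'p)"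
  assume "w \<noteq> 0"
  then obtain c0 where "w $ c0 \<noteq> 0" by (auto simp: vec_eq_iff)
  have pos_s: "1 \<le> pos s" "pos s \<le> N - n" for s :: 's
    using bij_betw_apply[OF bij_betw_pos, of s] card by auto
  \<comment> \<open>An entry in the last block on which \<open>w\<close> does not vanish; other
    components of the same block may be nonzero as well.\<close>
  obtain c where c: "w $ c \<noteq> 0" "\<And>c'. w $ c' \<noteq> 0 \<Longrightarrow> pos (fst c') \<le> pos (fst c)"
  proof -
    have "\<forall>c. w $ c \<noteq> 0 \<longrightarrow> pos (fst c) < Suc (N - n)"
      using pos_s(2) by (simp add: less_Suc_eq_le)
    from ex_has_greatest_nat[OF \<open>w $ c0 \<noteq> 0\<close> this] show ?thesis
      using that by blast
  qed
  obtain \<M>' where \<M>': "\<And>z. (\<M> has_derivative blinfun_apply (\<M>' z)) (at z)"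
    using \<M> by (rule twice_continuously_differentiableE) blast
  note D = constraints_has_derivative[OF \<M>', of n u x, where 's = 's]
  have pos_l: "1 \<le> pos j" "pos j \<le> n" for j :: 'l
    using bij_betw_apply[OF bij_betw_pos, of j] card by auto
  \<comment> \<open>\<open>slot\<close> is unspecified outside the positions 1 to \<open>N\<close>,
    so each time index compared below has to be placed in this range.\<close>
  have slot_eq: "slot i = (slot j :: 't) \<longleftrightarrow> i = j" if "1 \<le> i" "i \<le> N" "1 \<le> j" "j \<le> N" for i j
    using that pos_slot[where 'i = 't] card by metis
  define d :: "real^('k + ('t \<times> 'p))" where "d = axis (Inr (slot (pos (fst c) + n), snd c)) 1"
  \<comment> \<open>Later blocks may feel the perturbation \<open>d\<close> through the model, but
    there \<open>w\<close> is zero.\<close>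
  have J: "(jacobian ?h (at x) *v d) $ c' = (if c' = c then 1 else 0)" if c': "w $ c' \<noteq> 0" for c'
  proof -
    have "(jacobian ?h (at x) *v d) $ c' = output_of d (pos (fst c') + n) $ snd c'
        - blinfun_apply (\<M>' (model_args n u (pos (fst c')) x))
            (\<chi> j. output_of d (pos (fst c') + n - pos j), 0, param_of d) $ snd c'"
      using jacobian_nth[OF D] by (simp add: d_def matrix_vector_mult_basis column_def)
    moreover have "(\<chi> j::'l. output_of d (pos (fst c') + n - pos j), 0 :: (real^'q)^'r::{finite,linorder}, param_of d) = 0"
    proof -
      \<comment> \<open>\<open>pos j\<close> is at least 1, so the model reads only times before the
        perturbed one, and at most \<open>n\<close>, so these times are at least 1.\<close>
      have "output_of d (pos (fst c') + n - pos j) = 0" for j :: 'l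
      proof -
        have "slot (pos (fst c') + n - pos j) \<noteq> (slot (pos (fst c) + n) :: 't)"
          using pos_l[of j] pos_s[of "fst c"] pos_s[of "fst c'"] c(2)[OF c']
          by (subst slot_eq) auto
        then show ?thesis by (auto simp: output_of_def d_def axis_def vec_eq_iff)
      qed
      moreover have "param_of d = 0" by (simp add: param_of_def d_def axis_def vec_eq_iff)
      ultimately show ?thesis by (simp add: zero_prod_def vec_eq_iff)
    qed
    moreover have "output_of d (pos (fst c') + n) $ snd c' = (if c' = c then 1 else 0)"
    proof -
      have "slot (pos (fst c') + n) = (slot (pos (fst c) + n) :: 't) \<longleftrightarrow> fst c' = fst c"
        using pos_s[of "fst c"] pos_s[of "fst c'"] slot_pos[of "fst c"] slot_pos[of "fst c'"]
        by (subst slot_eq) auto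
      then show ?thesis by (auto simp: output_of_def d_def axis_def prod_eq_iff)
    qed
    ultimately show ?thesis by (simp add: blinfun.zero_right)
  qed
  have "0 = (w v* jacobian ?h (at x)) \<bullet> d" by (simp add: w)
  also have "\<dots> = (\<Sum>c'\<in>UNIV. w $ c' * (jacobian ?h (at x) *v d) $ c')"
    unfolding dot_lmul_matrix by (simp add: inner_vec_def)
  also have "\<dots> = (\<Sum>c'\<in>UNIV. if c' = c then w $ c else 0)"
  proof (rule sum.cong)
    show "w $ c' * (jacobian ?h (at x) *v d) $ c' = (if c' = c then w $ c else 0)" for c'
      using J[of c'] c(1) by (cases "w $ c' = 0") auto
  qed simp
  finally show False using c(1) by simp
qed

theorem theorem2:
  fixes n N :: nat
    and \<M> :: "((real^'p)^'l::{finite,linorder}) \<times> ((real^'q)^'r::{finite,linorder}) \<times> (real^'k) \<Rightarrow> real^'p"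
    and \<rho> :: "real^'k \<Rightarrow> real"
    and u :: "nat \<Rightarrow> real^'q"
    and ym :: "nat \<Rightarrow> real^'p"
    and W :: "real^'p^'p"
    and K :: real
    and f :: "real^('k::finite + ('t::{finite,linorder} \<times> 'p::finite)) \<Rightarrow> real"
    and h :: "real^('k + ('t \<times> 'p)) \<Rightarrow> real^('s::{finite,linorder} \<times> 'p)"
    and \<xi>s :: "real^('k + ('t \<times> 'p))"
    and lams :: "real^('s \<times> 'p)"
  assumes "0 < n" and "n < N"
    and "CARD('l) = n" and "CARD('r) = n + 1" and "CARD('t) = N" and "CARD('s) = N - n"
    and "twice_continuously_differentiable \<M>"
    and "twice_continuously_differentiable \<rho>"
    and "positive_definite W"
    and "f = fit_cost N W ym \<rho>"
    and "h = constraints n \<M> u"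
    and "0 < K"
    and "second_order_sufficient f h \<xi>s lams"
  shows "\<exists>\<tau>bar>0. \<forall>\<tau>. 0 < \<tau> \<and> \<tau> < \<tau>bar \<longrightarrow>
           fl_step \<tau> K f h \<xi>s = \<xi>s \<and>
           fl_multiplier K f h \<xi>s = lams \<and>
           locally_asymptotically_stable (fl_step \<tau> K f h) \<xi>s"
proof (rule fl_step_locally_asymptotically_stable)
  show "grad f differentiable (at \<xi>s)"
    unfolding \<open>f = _\<close> using assms by (intro grad_fit_cost_differentiable)
  obtain \<M>' where \<M>': "\<And>z. (\<M> has_derivative blinfun_apply (\<M>' z)) (at z)"
    "\<And>z. \<M>' differentiable (at z)"
    using \<open>twice_continuously_differentiable \<M>\<close> by (rule twice_continuously_differentiableE) blast
  note D = constraints_has_derivative[OF \<M>'(1), of n u, where 's = 's and 't = 't, folded \<open>h = _\<close>]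
  show "h differentiable (at x)" for x
    using D by (rule differentiableI)
  \<comment> \<open>For a fixed unit direction an entry is a constant minus a component of
    \<open>\<M>'\<close> at the affine argument \<open>model_args\<close>, applied to a fixed
    vector.\<close>
  have "(\<lambda>x. jacobian h (at x) $ c $ j) differentiable (at \<xi>s)" for c j
    unfolding jacobian_nth[OF D] vec_lambda_beta
    by (intro differentiable_diff differentiable_const differentiable_vec_nth
        differentiable_blinfun_apply \<M>'(2) differentiableI[OF model_args_has_derivative])
  then have "\<And>c. (\<lambda>x. jacobian h (at x) $ c) differentiable (at \<xi>s)"
    by (rule differentiable_vec_nth_iff[THEN iffD2, rule_format])
  then show "(\<lambda>x. jacobian h (at x)) differentiable (at \<xi>s)"
    by (rule differentiable_vec_nth_iff[THEN iffD2, rule_format])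
  show "w = 0" if "w v* jacobian h (at x) = 0" for x w
    using constraints_jacobian_full_rank[OF \<open>twice_continuously_differentiable \<M>\<close>
        \<open>CARD('l) = n\<close> \<open>CARD('t) = N\<close> \<open>CARD('s) = N - n\<close>] that
    unfolding \<open>h = _\<close> .
qed (use assms in auto)

end
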